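(* Let $p\in(0,1)$ and let $(f_n)_{n\ge1}$ be a sequence of nonnegative reals with $\sum_{n\ge1}f_n=1$ and $\gcd\{n\ge1:f_n>0\}=1$. Suppose that $nf_n=C\sum_{j>n}f_j\,(1+o(1))$ as $n\to\infty$ and that $f_n=O(n^{-(\beta+1)})$, for some $C>0$ and $\beta>0$. Set $\mathring f_n=pf_n$ for $n\ge1$, and define $(\mathring u_n)_{n\ge0}$ by $\mathring u_0=1$ and $\mathring u_n=\sum_{j=1}^n\mathring f_j\,\mathring u_{n-j}$ for $n\ge1$. Let $\tau$ be a random variable with $\nu(\tau=n)=f_n$ for $n\ge1$. Then, as $n\to\infty$, $$\mathring u_n=(1-p)^{-2}\,\mathring f_n\,(1+o(1))=p(1-p)^{-2}\,\nu(\tau=n)\,(1+o(1)).$$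
   Context: $(\mathring u_n)$ is the renewal sequence of a transient renewal Markov chain, obtained from a recurrent renewal chain whose first return time $\tau$ to state $0$ has law $f_n=\nu(\tau=n)$ under the probability measure $\nu$, by introducing a hole so that the new first return time $\mathring\tau$ satisfies $\nu(\mathring\tau=n)=p\,\nu(\tau=n)=\mathring f_n$.
   Formalization: The relation a_n = b_n(1+o(1)) is read as a_n/b_n → 1 with b_n nonzero for all large n; this excludes finitely supported f (e.g. f_1 = 1, where ů_n = p^n), for which the tail condition holds as 0 = 0 and the conclusion fails. *)

theory Defs
  imports "HOL-Probability.Probability" "HOL-Library.Landau_Symbols"
begin

text \<open>
  \<open>a\<close> and \<open>b\<close> satisfy \<open>a n = b n * (1 + o(1))\<close> in the sense that \<open>a n / b n\<close> tends to 1,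
  where the quotient is required to be meaningful for all large \<open>n\<close>.
  The library relation alone treats \<open>0 / 0\<close> as 1, so it also relates two sequences that
  vanish eventually.  For the tail condition on a return time distribution this
  would admit finitely supported distributions, such as \<open>f 1 = 1\<close>; then the renewal sequence
  is \<open>p ^ n\<close>, which is not asymptotic to a sequence vanishing for \<open>n \<ge> 2\<close>.
\<close>

definition asymp_ratio_one :: "(nat \<Rightarrow> real) \<Rightarrow> (nat \<Rightarrow> real) \<Rightarrow> bool"
  where "asymp_ratio_one a b \<longleftrightarrow>
    (\<forall>\<^sub>F n in sequentially. b n \<noteq> 0) \<and> a \<sim>[sequentially] b"

end

theory Submission
  imports Defs
begin

text \<open>
  Write \<open>T n\<close> for the tail sum. The relation \<open>n * f n \<sim> C * T n\<close> makes \<open>f (n - k) / f n\<close> tend to 1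
  for every fixed \<open>k\<close>, and it bounds \<open>f m / f n\<close> uniformly for \<open>n / 2 \<le> m \<le> n\<close>; this is all the
  regular variation that is needed. Split the convolution in the renewal equation at \<open>n / 2\<close> and
  put \<open>r n = u n / f n\<close>. By dominated convergence the half in which \<open>u\<close> has the small argument
  contributes \<open>p * (\<Sum>k. u k) = p / (1 - p)\<close> in the limit, while the other half is a weighted average
  of the values \<open>r m\<close>, \<open>n / 2 \<le> m < n\<close>, of total weight tending to \<open>p\<close>. Hence the distance
  of \<open>r n\<close> to the fixed point \<open>c = p * c + p / (1 - p)\<close> contracts by a factor close to \<open>p < 1\<close>, which
  yields first the boundedness of \<open>r\<close> and then the convergence to \<open>c = p / (1 - p)\<^sup>2\<close>.
\<close>

section \<open>Regularity of \<open>g\<close> from its relation to the tail \<open>T\<close>\<close>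

text \<open>Going down one index adds \<open>g (m + Suc d) <= (B / m) * T (m + Suc d)\<close> to the
  tail, the denominator being frozen at its smallest value \<open>m\<close>. Each of the
  \<open>d\<close> steps costs a factor \<open>1 + B / m <= exp (B / m)\<close>.\<close>

lemma tail_exp_bound:
  fixes g T :: "nat \<Rightarrow> real"
  assumes rec: "\<And>n. T n = g (Suc n) + T (Suc n)"
    and T_pos: "\<And>n. n \<ge> N \<Longrightarrow> 0 < T n"
    and g_le: "\<And>n. n \<ge> N \<Longrightarrow> real n * g n \<le> B * T n"
    and m: "N \<le> m" "0 < m" and B: "0 \<le> B"
  shows "T m \<le> T (m + d) * exp (B * d / m)"
proof (induction d)
  case 0
  then show ?case by simp
next
  case (Suc d)
  have pos: "0 < T (m + Suc d)" using T_pos m by simp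
  have "g (m + Suc d) \<le> B * T (m + Suc d) / real (m + Suc d)"
    using g_le[of "m + Suc d"] m by (simp add: field_simps)
  also have "\<dots> \<le> B * T (m + Suc d) / real m"
    using m B pos by (intro divide_left_mono) auto
  finally have "T (m + d) \<le> T (m + Suc d) * (1 + B / m)"
    using rec[of "m + d"] by (simp add: algebra_simps)
  also have "\<dots> \<le> T (m + Suc d) * exp (B / m)"
    using pos exp_ge_add_one_self[of "B / m"] by (intro mult_left_mono) auto
  finally have "T (m + d) * exp (B * d / m) \<le> T (m + Suc d) * exp (B / m) * exp (B * d / m)"
    by (intro mult_right_mono) auto
  also have "\<dots> = T (m + Suc d) * exp (B * Suc d / m)"
    by (simp add: exp_add [symmetric] add_divide_distrib distrib_left add.commute)
  finally show ?case using Suc by simp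
qed

text \<open>Both \<open>m * g m\<close> and \<open>n * g n\<close> are comparable to the tails at
  \<open>m\<close> and \<open>n\<close>, and for \<open>n <= 2 * m\<close> these tails differ by a
  bounded factor, since \<open>(n - m) / m <= 1\<close> in the exponential bound.\<close>

lemma tail_ratio_dominated:
  fixes g T :: "nat \<Rightarrow> real"
  assumes rec: "\<And>n. T n = g (Suc n) + T (Suc n)"
    and T_pos: "\<forall>\<^sub>F n in sequentially. 0 < T n"
    and lim: "(\<lambda>n. real n * g n / T n) \<longlonglongrightarrow> C" and C: "0 < C"
  shows "\<exists>K. \<forall>\<^sub>F n in sequentially. \<forall>m. m \<le> n \<longrightarrow> n \<le> 2 * m \<longrightarrow> g m \<le> K * g n"
proof -
  have "\<forall>\<^sub>F n in sequentially. C / 2 < real n * g n / T n"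
    "\<forall>\<^sub>F n in sequentially. real n * g n / T n < 2 * C"
    using C by (intro order_tendstoD[OF lim]; simp)+
  with T_pos have "\<forall>\<^sub>F n in sequentially. 0 < T n \<and> C / 2 * T n \<le> real n * g n \<and>
      real n * g n \<le> 2 * C * T n"
    by eventually_elim (simp add: field_simps)
  then obtain N where N: "\<And>n. n \<ge> N \<Longrightarrow> 0 < T n"
      "\<And>n. n \<ge> N \<Longrightarrow> C / 2 * T n \<le> real n * g n"
      "\<And>n. n \<ge> N \<Longrightarrow> real n * g n \<le> 2 * C * T n"
    unfolding eventually_sequentially by blast
  \<comment> \<open>The 8 combines a factor 2 from \<open>n <= 2 * m\<close> with the quotient 4 of
    the bounds \<open>2 * C\<close> and \<open>C / 2\<close>; \<open>exp (2 * C)\<close> is the tail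
    comparison with \<open>B = 2 * C\<close>.\<close>
  have "g m \<le> 8 * exp (2 * C) * g n" if n: "n \<ge> 2 * N + 1" and m: "m \<le> n" "n \<le> 2 * m" for m n
  proof -
    have m0: "N \<le> m" "0 < m" "N \<le> n" "0 < n" using n m by auto
    have "T m \<le> T (m + (n - m)) * exp (2 * C * (n - m) / m)"
      by (rule tail_exp_bound[OF rec N(1) N(3)]) (use m0 C in auto)
    also have "\<dots> \<le> T n * exp (2 * C)"
      using m m0 C N(1)[of n] by (auto simp: field_simps intro!: mult_left_mono)
    finally have T: "T m \<le> T n * exp (2 * C)" .
    have "real n * g m \<le> 2 * (real m * g m)"
    proof -
      have "0 < C / 2 * T m" using N(1)[of m] m0 C by simp
      then have "0 < real m * g m" using N(2)[of m] m0 by linarith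
      then have "0 \<le> g m" by (simp add: zero_less_mult_iff)
      moreover have "real n \<le> 2 * real m" using m by linarith
      ultimately show ?thesis using mult_right_mono[of "real n" "2 * real m" "g m"] by simp
    qed
    also have "\<dots> \<le> 2 * (2 * C * T m)" using N(3)[of m] m0 by simp
    also have "\<dots> \<le> 2 * (2 * C * (T n * exp (2 * C)))"
      using T C by simp
    also have "\<dots> = 8 * exp (2 * C) * (C / 2 * T n)" by simp
    also have "\<dots> \<le> 8 * exp (2 * C) * (real n * g n)"
      using N(2)[of n] m0 by (intro mult_left_mono) auto
    finally show ?thesis using m0 by (simp add: field_simps)
  qed
  then show ?thesis
    unfolding eventually_sequentially by blast
qed

text \<open>For \<open>x n = n * g n / T n\<close>, the quotient
  \<open>T n / T (Suc n) = 1 + x (Suc n) / Suc n\<close> tends to 1, and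
  \<open>g n / g (Suc n)\<close> is the product of the quotients of \<open>x\<close>, of
  \<open>T\<close> and of \<open>Suc n / n\<close>.\<close>

lemma tail_ratio_long_tailed:
  fixes g T :: "nat \<Rightarrow> real"
  assumes rec: "\<And>n. T n = g (Suc n) + T (Suc n)"
    and T_pos: "\<forall>\<^sub>F n in sequentially. 0 < T n"
    and lim: "(\<lambda>n. real n * g n / T n) \<longlonglongrightarrow> C" and C: "0 < C"
  shows "\<forall>\<^sub>F n in sequentially. 0 < g n" and "(\<lambda>n. g n / g (Suc n)) \<longlonglongrightarrow> 1"
proof -
  define x where "x = (\<lambda>n. real n * g n / T n)"
  have x: "x \<longlonglongrightarrow> C" using lim by (simp add: x_def)
  have x_pos: "\<forall>\<^sub>F n in sequentially. 0 < x n" using order_tendstoD(1)[OF x C] .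
  from x_pos T_pos show pos: "\<forall>\<^sub>F n in sequentially. 0 < g n"
    by eventually_elim (auto simp: x_def zero_less_divide_iff zero_less_mult_iff)
  note ev_Suc = x_pos[THEN eventually_sequentially_Suc[THEN iffD2]]
    T_pos[THEN eventually_sequentially_Suc[THEN iffD2]]
    pos[THEN eventually_sequentially_Suc[THEN iffD2]]
  have inv: "(\<lambda>n. 1 / real (Suc n)) \<longlonglongrightarrow> 0"
    using LIMSEQ_inverse_real_of_nat by (simp add: inverse_eq_divide)
  have xS: "(\<lambda>n. x (Suc n)) \<longlonglongrightarrow> C" using x by (rule LIMSEQ_Suc)
  have "(\<lambda>n. x (Suc n) * (1 / real (Suc n)) + 1) \<longlonglongrightarrow> C * 0 + 1"
    by (intro tendsto_intros xS inv)
  moreover have "\<forall>\<^sub>F n in sequentially. x (Suc n) * (1 / real (Suc n)) + 1 = T n / T (Suc n)"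
    using ev_Suc(2)
  proof eventually_elim
    case (elim n)
    then show ?case using rec[of n] by (simp add: x_def add_divide_distrib)
  qed
  ultimately have "(\<lambda>n. T n / T (Suc n)) \<longlonglongrightarrow> C * 0 + 1"
    by (rule Lim_transform_eventually)
  then have T: "(\<lambda>n. T n / T (Suc n)) \<longlonglongrightarrow> 1" by simp
  have n: "(\<lambda>n. real (Suc n) / real n) \<longlonglongrightarrow> 1"
    by (rule LIMSEQ_Suc_n_over_n)
  have "(\<lambda>n. x n / x (Suc n) * (T n / T (Suc n)) * (real (Suc n) / real n)) \<longlonglongrightarrow> C / C * 1 * 1"
    by (intro tendsto_intros x xS T n) (use C in auto)
  moreover have "\<forall>\<^sub>F n in sequentially.
      x n / x (Suc n) * (T n / T (Suc n)) * (real (Suc n) / real n) = g n / g (Suc n)"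
    using T_pos ev_Suc(2,3) eventually_gt_at_top[of 0]
    by eventually_elim (simp add: x_def)
  ultimately have "(\<lambda>n. g n / g (Suc n)) \<longlonglongrightarrow> C / C * 1 * 1"
    by (rule Lim_transform_eventually)
  then show "(\<lambda>n. g n / g (Suc n)) \<longlonglongrightarrow> 1" using C by simp
qed

lemma long_tailed_shift:
  fixes g :: "nat \<Rightarrow> real"
  assumes pos: "\<forall>\<^sub>F n in sequentially. 0 < g n" and lim: "(\<lambda>n. g n / g (Suc n)) \<longlonglongrightarrow> 1"
  shows "(\<lambda>n. g (n - k) / g n) \<longlonglongrightarrow> 1"
proof -
  \<comment> \<open>The forward ratio telescopes without truncated subtraction; a shift of the index
    by \<open>k\<close> then gives the claim.\<close>
  have "(\<lambda>n. g n / g (n + k)) \<longlonglongrightarrow> 1"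
  proof (induction k)
    case 0
    have "\<forall>\<^sub>F n in sequentially. g n / g (n + 0) = 1"
      using pos by eventually_elim simp
    then show ?case by (rule tendsto_eventually)
  next
    case (Suc k)
    have "(\<lambda>n. g n / g (n + k) * (g (n + k) / g (Suc (n + k)))) \<longlonglongrightarrow> 1 * 1"
      by (intro tendsto_mult Suc LIMSEQ_ignore_initial_segment[OF lim])
    moreover have "\<forall>\<^sub>F n in sequentially.
        g n / g (n + k) * (g (n + k) / g (Suc (n + k))) = g n / g (n + Suc k)"
      using sequentially_offset[OF pos, of k] by eventually_elim simp
    ultimately have "(\<lambda>n. g n / g (n + Suc k)) \<longlonglongrightarrow> 1 * 1"
      by (rule Lim_transform_eventually)
    then show ?case by simp
  qed
  then show ?thesis
    using LIMSEQ_offset [of "\<lambda>n. g (n - k) / g n" k] by simp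
qed

section \<open>Two limit tools: half convolutions and contraction over half ranges\<close>

text \<open>An instance of Tannery's theorem: \<open>2 * k <= n\<close> keeps \<open>n - k\<close>
  in the range where \<open>dom\<close> applies, so \<open>v k * \<bar>K\<bar>\<close> is a summable
  majorant. The index set \<open>A\<close> is general so as to allow both \<open>2 * k <= n\<close>
  and \<open>2 * k < n\<close>.\<close>

lemma half_convolution_limit:
  fixes g v :: "nat \<Rightarrow> real"
  assumes g_nonneg: "\<And>n. 0 \<le> g n"
    and shift: "\<And>k. (\<lambda>n. g (n - k) / g n) \<longlonglongrightarrow> 1"
    and dom: "\<forall>\<^sub>F n in sequentially. \<forall>m. m \<le> n \<longrightarrow> n \<le> 2 * m \<longrightarrow> g m \<le> K * g n"
    and g_pos: "\<forall>\<^sub>F n in sequentially. 0 < g n"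
    and v: "\<And>k. 0 \<le> v k" "summable v"
    and A: "\<And>n. A n \<subseteq> {k. 2 * k \<le> n}" "\<And>k. \<forall>\<^sub>F n in sequentially. k \<in> A n"
  shows "(\<lambda>n. \<Sum>k\<in>A n. v k * (g (n - k) / g n)) \<longlonglongrightarrow> suminf v"
proof -
  define a where "a = (\<lambda>k n. if k \<in> A n then v k * (g (n - k) / g n) else 0)"
  have lim: "a k \<longlonglongrightarrow> v k" for k
  proof -
    have "(\<lambda>n. v k * (g (n - k) / g n)) \<longlonglongrightarrow> v k * 1"
      by (intro tendsto_intros shift)
    moreover have "\<forall>\<^sub>F n in sequentially. v k * (g (n - k) / g n) = a k n"
      using A(2)[of k] by eventually_elim (simp add: a_def)
    ultimately have "a k \<longlonglongrightarrow> v k * 1"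
      by (rule Lim_transform_eventually)
    then show ?thesis by simp
  qed
  have "\<forall>\<^sub>F n in sequentially. \<forall>k. norm (a k n) \<le> v k * \<bar>K\<bar>"
    using dom g_pos
  proof eventually_elim
    case (elim n)
    show ?case
    proof
      fix k
      show "norm (a k n) \<le> v k * \<bar>K\<bar>"
      proof (cases "k \<in> A n")
        case True
        then have "2 * k \<le> n" using A(1) by auto
        then have "g (n - k) \<le> K * g n" using elim(1) by auto
        then have "g (n - k) / g n \<le> \<bar>K\<bar>"
          using elim(2) by (simp add: pos_divide_le_eq)
            (meson abs_ge_self less_imp_le mult_right_mono order_trans)
        then have "v k * (g (n - k) / g n) \<le> v k * \<bar>K\<bar>"
          using v(1) by (intro mult_left_mono)
        moreover have "0 \<le> v k * (g (n - k) / g n)"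
          using v(1) g_nonneg by simp
        ultimately show ?thesis
          using True by (simp only: a_def real_norm_def) simp
      next
        case False
        then show ?thesis using v(1) by (simp add: a_def)
      qed
    qed
  qed
  \<comment> \<open>The threshold for \<open>n\<close> serves all \<open>k\<close> at once, so the
    product filter needs no condition on \<open>k\<close>.\<close>
  then have bound: "eventually (\<lambda>(k,n). norm (a k n) \<le> v k * \<bar>K\<bar>) (at_top \<times>\<^sub>F sequentially)"
    unfolding eventually_prod_filter
    by (intro exI[of _ "\<lambda>_. True"] exI[of _ "\<lambda>n. \<forall>k. norm (a k n) \<le> v k * \<bar>K\<bar>"]) auto
  have "summable (\<lambda>k. v k * \<bar>K\<bar>)" using v(2) by (rule summable_mult2)
  then have "(\<lambda>n. \<Sum>k. a k n) \<longlonglongrightarrow> suminf v"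
    using tannerys_theorem[OF lim bound] by simp
  moreover have "(\<Sum>k. a k n) = (\<Sum>k\<in>A n. v k * (g (n - k) / g n))" for n
  proof -
    have "finite (A n)" by (rule finite_subset[OF A(1)], rule finite_subset[of _ "{..n}"]) auto
    then have "(\<Sum>k. a k n) = (\<Sum>k\<in>A n. a k n)" by (rule suminf_finite) (simp add: a_def)
    then show ?thesis by (simp add: a_def)
  qed
  ultimately show ?thesis by simp
qed

text \<open>A bound \<open>B\<close> valid from \<open>M\<close> on improves to
  \<open>r * B + e\<close> from some later index on, because \<open>step\<close> looks back only to
  \<open>n / 2\<close>. The quantifier over \<open>B\<close> stands inside the eventuality, so the
  threshold is independent of \<open>B\<close>; this lets an induction first establish that
  \<open>D\<close> is bounded.\<close>

lemma half_range_contraction_tendsto_0: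
  fixes D q \<delta> :: "nat \<Rightarrow> real"
  assumes D_nonneg: "\<And>n. 0 \<le> D n"
    and q: "q \<longlonglongrightarrow> p" "p < 1" "\<And>n. 0 \<le> q n" and \<delta>: "\<delta> \<longlonglongrightarrow> 0"
    and step: "\<forall>\<^sub>F n in sequentially. \<forall>B.
      (\<forall>m<n. n \<le> 2 * m \<longrightarrow> D m \<le> B) \<longrightarrow> D n \<le> q n * B + \<delta> n"
  shows "D \<longlonglongrightarrow> 0"
proof -
  \<comment> \<open>A fixed factor below 1 that eventually dominates \<open>q n\<close>.\<close>
  obtain r where r: "p < r" "r < 1" using q(2) dense by blast
  have "0 \<le> p" using q(1,3) by (meson LIMSEQ_le_const)
  with r have "0 < r" by simp
  have contract: "\<forall>\<^sub>F n in sequentially. \<forall>B\<ge>0.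
      (\<forall>m<n. n \<le> 2 * m \<longrightarrow> D m \<le> B) \<longrightarrow> D n \<le> r * B + e" if "0 < e" for e
    using step order_tendstoD(2)[OF q(1) r(1)] order_tendstoD(2)[OF \<delta> that]
  proof eventually_elim
    case (elim n)
    show ?case
    proof (intro allI impI)
      fix B assume B: "B \<ge> 0" "\<forall>m<n. n \<le> 2 * m \<longrightarrow> D m \<le> B"
      have "q n * B \<le> r * B" using elim(2) B(1) by (intro mult_right_mono) auto
      then show "D n \<le> r * B + e" using elim B(2) by force
    qed
  qed
  obtain N where N: "\<And>n B. n \<ge> N \<Longrightarrow> 0 \<le> B \<Longrightarrow>
      (\<forall>m<n. n \<le> 2 * m \<longrightarrow> D m \<le> B) \<Longrightarrow> D n \<le> r * B + 1"
    using contract[of 1] unfolding eventually_sequentially by auto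
  \<comment> \<open>The map \<open>B \<mapsto> r * B + 1\<close> has fixed point
    \<open>1 / (1 - r)\<close>, so it does not increase any \<open>B\<close> above that value; the
    finite sum covers the indices below \<open>N\<close>.\<close>
  define B0 where "B0 = 1 / (1 - r) + (\<Sum>m<N. D m)"
  have "0 \<le> B0" using r D_nonneg by (simp add: B0_def sum_nonneg)
  have "D n \<le> B0" for n
  proof (induction n rule: less_induct)
    case (less n)
    show ?case
    proof (cases "n < N")
      case True
      then have "D n \<le> (\<Sum>m<N. D m)" by (intro member_le_sum) (auto simp: D_nonneg)
      then show ?thesis using r by (simp add: B0_def add_increasing)
    next
      case False
      then have "D n \<le> r * B0 + 1" using less N[of n B0] \<open>0 \<le> B0\<close> by simp
      also have "1 / (1 - r) \<le> B0" by (simp add: B0_def D_nonneg sum_nonneg)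
      then have "r * B0 + 1 \<le> B0" using r by (simp add: field_simps)
      finally show ?thesis .
    qed
  qed
  \<comment> \<open>Since \<open>e / (1 - r)\<close> is the fixed point of
    \<open>B \<mapsto> r * B + e\<close>, each round only shrinks the excess by the factor
    \<open>r\<close>; the index from which the bound holds must at least double.\<close>
  have improve: "\<forall>\<^sub>F n in sequentially. D n \<le> r ^ k * B0 + e / (1 - r)" if e: "0 < e" for k e
  proof (induction k)
    case 0
    show ?case using \<open>\<And>n. D n \<le> B0\<close> r e by (auto intro!: always_eventually add_increasing2)
  next
    case (Suc k)
    let ?B = "r ^ k * B0 + e / (1 - r)"
    have B: "0 \<le> ?B" using \<open>0 < r\<close> \<open>0 \<le> B0\<close> r e by simp
    have eq: "r * ?B + e = r ^ Suc k * B0 + e / (1 - r)"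
      using r by (simp add: field_simps)
    obtain M where M: "\<And>n. n \<ge> M \<Longrightarrow> D n \<le> ?B"
      using Suc unfolding eventually_sequentially by blast
    show ?case
      using contract[OF e] eventually_ge_at_top[of "2 * M"]
    proof eventually_elim
      case (elim n)
      have "\<forall>m<n. n \<le> 2 * m \<longrightarrow> D m \<le> ?B" using elim(2) M by auto
      then have "D n \<le> r * ?B + e" using elim(1) B by blast
      then show ?case unfolding eq .
    qed
  qed
  show ?thesis
  proof (rule order_tendstoI)
    fix a :: real assume "a < 0"
    then show "\<forall>\<^sub>F n in sequentially. a < D n"
      using D_nonneg by (auto intro!: always_eventually less_le_trans[of a 0])
  next
    fix a :: real assume a: "0 < a"
    have "(\<lambda>k. r ^ k * B0) \<longlonglongrightarrow> 0 * B0"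
      using r \<open>0 < r\<close> by (intro tendsto_mult tendsto_const LIMSEQ_power_zero) auto
    then obtain k where k: "r ^ k * B0 < a / 2"
      using a order_tendstoD(2)[of _ 0 sequentially "a / 2"] eventually_sequentially by fastforce
    \<comment> \<open>This choice of \<open>e\<close> makes the residue \<open>e / (1 - r)\<close>
      equal to \<open>a / 2\<close>.\<close>
    have "0 < a / 2 * (1 - r)" "a / 2 * (1 - r) / (1 - r) = a / 2"
      using a r nonzero_mult_div_cancel_right[of "1 - r" "a / 2"] by auto
    then have "\<forall>\<^sub>F n in sequentially. D n \<le> r ^ k * B0 + a / 2"
      using improve[of "a / 2 * (1 - r)" k] by (simp only:)
    then show "\<forall>\<^sub>F n in sequentially. D n < a"
      by eventually_elim (use k in linarith)
  qed
qed

section \<open>The defective renewal equation\<close>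

text \<open>Summing the renewal equation over \<open>n < N\<close> gives
  \<open>U <= 1 + p * U\<close> for the partial sum \<open>U\<close>, hence summability; the Cauchy
  product then turns this into an equality for the full sum.\<close>

lemma defective_renewal_sums:
  fixes g u :: "nat \<Rightarrow> real"
  assumes g: "\<And>n. 0 \<le> g n" "g sums 1" and p: "0 < p" "p < 1"
    and u0: "u 0 = 1" and u_rec: "\<And>n. n \<ge> 1 \<Longrightarrow> u n = p * (\<Sum>j\<le>n. g j * u (n - j))"
    and g0: "g 0 = 0"
  shows "\<And>n. 0 \<le> u n" and "u sums (1 / (1 - p))"
proof -
  show u_nonneg: "0 \<le> u n" for n
  proof (induction n rule: less_induct)
    case (less n)
    show ?case
    proof (cases "n = 0")
      case False
      \<comment> \<open>As \<open>g 0 = 0\<close>, the term containing \<open>u n\<close> itself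
        vanishes and the induction is well founded.\<close>
      have "0 \<le> g j * u (n - j)" for j
        using less[of "n - j"] g(1)[of j] g0 False by (cases "j = 0") auto
      then show ?thesis using u_rec[of n] False p by (simp add: sum_nonneg)
    qed (simp add: u0)
  qed
  have u_eq: "u n = (if n = 0 then 1 else 0) + p * (\<Sum>j\<le>n. g j * u (n - j))" for n
    using u_rec[of n] by (cases "n = 0") (auto simp: u0 g0)
  have "(\<Sum>n<N. u n) \<le> 1 / (1 - p)" for N
  proof -
    \<comment> \<open>The triangle \<open>j + k < N\<close> is enlarged to a square, over which the
      sum factors.\<close>
    have "(\<Sum>n<N. \<Sum>j\<le>n. g j * u (n - j)) = (\<Sum>(j,k)\<in>{(j,k). j + k < N}. g j * u k)"
      by (rule sum.triangle_reindex [symmetric])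
    also have "\<dots> \<le> (\<Sum>(j,k)\<in>{..<N} \<times> {..<N}. g j * u k)"
      by (intro sum_mono2) (auto simp: g u_nonneg)
    also have "\<dots> = (\<Sum>j<N. g j) * (\<Sum>k<N. u k)"
      by (simp add: sum_product sum.cartesian_product)
    also have "\<dots> \<le> 1 * (\<Sum>k<N. u k)"
      using g sum_le_suminf[of g "{..<N}"] u_nonneg
      by (intro mult_right_mono sum_nonneg) (auto simp: sums_iff)
    finally have conv: "(\<Sum>n<N. \<Sum>j\<le>n. g j * u (n - j)) \<le> (\<Sum>k<N. u k)" by simp
    have "(\<Sum>n<N. u n) = (\<Sum>n<N. if n = 0 then 1 else 0) + p * (\<Sum>n<N. \<Sum>j\<le>n. g j * u (n - j))"
      by (subst u_eq) (simp only: sum.distrib sum_distrib_left)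
    also have "\<dots> \<le> 1 + p * (\<Sum>k<N. u k)"
      using conv p by (intro add_mono mult_left_mono) (auto simp: sum.delta)
    finally show ?thesis using p by (simp add: field_simps)
  qed
  then have sum: "summable u"
    using u_nonneg by (intro summableI_nonneg_bounded[where x = "1 / (1 - p)"]) auto
  have "(\<lambda>n. \<Sum>j\<le>n. g j * u (n - j)) sums ((\<Sum>k. g k) * (\<Sum>k. u k))"
    using g sum u_nonneg by (intro Cauchy_product_sums) (auto simp: sums_iff)
  then have "(\<lambda>n. (if n = 0 then 1 else 0) + p * (\<Sum>j\<le>n. g j * u (n - j))) sums (1 + p * suminf u)"
    using g(2) by (intro sums_add sums_mult sums_single) (simp add: sums_iff)
  then have "suminf u = 1 + p * suminf u"
    by (subst (asm) u_eq[symmetric]) (simp add: sums_iff)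
  then have "suminf u = 1 / (1 - p)" using p by (simp add: field_simps)
  then show "u sums (1 / (1 - p))" using sum by (simp add: sums_iff)
qed

text \<open>The contraction lemma is applied to \<open>\<bar>u n / g n - c\<bar>\<close> with factor
  \<open>p * W n\<close>; the error \<open>\<delta> n\<close> is the defect left when
  \<open>c\<close> is inserted into the normalised renewal equation.\<close>

lemma defective_renewal_asymptotics:
  fixes g u T :: "nat \<Rightarrow> real"
  assumes g: "\<And>n. 0 \<le> g n" "g sums 1" "g 0 = 0" and p: "0 < p" "p < 1"
    and rec: "\<And>n. T n = g (Suc n) + T (Suc n)"
    and T_pos: "\<forall>\<^sub>F n in sequentially. 0 < T n"
    and lim: "(\<lambda>n. real n * g n / T n) \<longlonglongrightarrow> C" and C: "0 < C"
    and u0: "u 0 = 1" and u_rec: "\<And>n. n \<ge> 1 \<Longrightarrow> u n = p * (\<Sum>j\<le>n. g j * u (n - j))"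
  shows "(\<lambda>n. u n / g n) \<longlonglongrightarrow> p / (1 - p)\<^sup>2"
proof -
  note u = defective_renewal_sums[OF g(1,2) p u0 u_rec g(3)]
  note tail = rec T_pos lim C
  have pos: "\<forall>\<^sub>F n in sequentially. 0 < g n"
    by (rule tail_ratio_long_tailed(1)[OF tail])
  note shift = long_tailed_shift[OF pos tail_ratio_long_tailed(2)[OF tail]]
  obtain K where K: "\<forall>\<^sub>F n in sequentially. \<forall>m. m \<le> n \<longrightarrow> n \<le> 2 * m \<longrightarrow> g m \<le> K * g n"
    using tail_ratio_dominated[OF tail] by blast
  define c where "c = p / (1 - p)\<^sup>2"
  \<comment> \<open>The middle index \<open>2 * j = n\<close> is counted in \<open>W\<close>, hence
    the strict inequality in \<open>S\<close>.\<close>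
  define W where "W = (\<lambda>n. \<Sum>j | 2 * j \<le> n. g j * (g (n - j) / g n))"
  define S where "S = (\<lambda>n. \<Sum>k | 2 * k < n. u k * (g (n - k) / g n))"
  have W: "W \<longlonglongrightarrow> 1"
  proof -
    have "\<forall>\<^sub>F n in sequentially. k \<in> {j. 2 * j \<le> n}" for k :: nat
      using eventually_ge_at_top[of "2 * k"] by simp
    then show ?thesis
      using half_convolution_limit[where v = g and A = "\<lambda>n. {j. 2 * j \<le> n}", OF g(1) shift K pos g(1)] g(2)
      by (simp add: W_def sums_iff)
  qed
  have S: "S \<longlonglongrightarrow> 1 / (1 - p)"
  proof -
    have "\<forall>\<^sub>F n in sequentially. k \<in> {j. 2 * j < n}" for k :: nat
      using eventually_gt_at_top[of "2 * k"] by simp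
    moreover have "{j. 2 * j < n} \<subseteq> {j. 2 * j \<le> n}" for n :: nat by auto
    ultimately show ?thesis
      using half_convolution_limit[where v = u and A = "\<lambda>n. {j. 2 * j < n}", OF g(1) shift K pos u(1)] u(2)
      by (simp add: S_def sums_iff)
  qed
  define \<delta> where "\<delta> = (\<lambda>n. \<bar>p * c * W n + p * S n - c\<bar>)"
  have "\<delta> \<longlonglongrightarrow> \<bar>p * c * 1 + p * (1 / (1 - p)) - c\<bar>"
    unfolding \<delta>_def by (intro tendsto_intros W S)
  moreover have "p * c * 1 + p * (1 / (1 - p)) - c = 0"
  proof -
    have "(1 - p) * c = p / (1 - p)" using p by (simp add: c_def power2_eq_square)
    then show ?thesis by (simp add: algebra_simps)
  qed
  ultimately have \<delta>: "\<delta> \<longlonglongrightarrow> 0" by simp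
  have q: "(\<lambda>n. p * W n) \<longlonglongrightarrow> p" using tendsto_mult[OF tendsto_const W, of p] by simp
  have W_nonneg: "0 \<le> W n" for n
    by (simp add: W_def g sum_nonneg)
  obtain N where N: "\<And>n. n \<ge> N \<Longrightarrow> 0 < g n"
    using pos unfolding eventually_sequentially by blast
  have step: "\<bar>u n / g n - c\<bar> \<le> p * W n * B + \<delta> n"
    if n: "n \<ge> 2 * N + 1" and B: "\<forall>m<n. n \<le> 2 * m \<longrightarrow> \<bar>u m / g m - c\<bar> \<le> B" for n B
  proof -
    have gn: "0 < g n" using N n by auto
    let ?L = "{j. 2 * j \<le> n}" and ?R = "{j. j \<le> n \<and> n < 2 * j}"
    have fin: "finite ?L" "finite ?R"
      by (rule finite_subset[of _ "{..n}"]; auto)+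
    have "{..n} = ?L \<union> ?R" by auto
    then have "(\<Sum>j\<le>n. g j * u (n - j)) = (\<Sum>j\<in>?L. g j * u (n - j)) + (\<Sum>j\<in>?R. g j * u (n - j))"
      using fin by (simp add: sum.union_disjoint[of ?L ?R] disjoint_iff)
    also have "(\<Sum>j\<in>?R. g j * u (n - j)) = (\<Sum>k | 2 * k < n. u k * g (n - k))"
      by (rule sum.reindex_bij_witness[of _ "\<lambda>k. n - k" "\<lambda>k. n - k"]) auto
    \<comment> \<open>For \<open>j\<close> in \<open>?L\<close>, \<open>n >= 2 * N + 1\<close>
      forces \<open>n - j >= N\<close>, so the division by \<open>g (n - j)\<close> is
      legitimate.\<close>
    also have "(\<Sum>j\<in>?L. g j * u (n - j)) = (\<Sum>j\<in>?L. g j * (g (n - j) * (u (n - j) / g (n - j))))"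
    proof (rule sum.cong)
      fix j assume "j \<in> ?L"
      then have "0 < g (n - j)" using n by (intro N) auto
      then show "g j * u (n - j) = g j * (g (n - j) * (u (n - j) / g (n - j)))" by simp
    qed simp
    finally have conv: "(\<Sum>j\<le>n. g j * u (n - j)) =
        (\<Sum>j\<in>?L. g j * (g (n - j) * (u (n - j) / g (n - j)))) + (\<Sum>k | 2 * k < n. u k * g (n - k))" .
    \<comment> \<open>Centring the ratios at \<open>c\<close> separates the constant part
      \<open>c * W n\<close>, which goes into the defect.\<close>
    have half_sum: "(\<Sum>j\<in>?L. g j * (g (n - j) * r j)) / g n
        = (\<Sum>j\<in>?L. g j * (g (n - j) / g n) * (r j - c)) + c * W n" for r
      unfolding W_def sum_divide_distrib sum_distrib_left sum.distrib [symmetric]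
      by (intro sum.cong refl) (simp add: algebra_simps add_divide_distrib [symmetric])
    have "S n = (\<Sum>k | 2 * k < n. u k * g (n - k)) / g n"
      by (simp add: S_def sum_divide_distrib)
    then have "u n / g n = p * ((\<Sum>j\<in>?L. g j * (g (n - j) * (u (n - j) / g (n - j)))) / g n + S n)"
      using u_rec[of n] n by (simp only: conv add_divide_distrib [symmetric] times_divide_eq_right)
    then have "u n / g n = p * ((\<Sum>j\<in>?L. g j * (g (n - j) / g n) * (u (n - j) / g (n - j) - c))
        + c * W n + S n)"
      unfolding half_sum .
    then have eq: "u n / g n - c =
        p * (\<Sum>j\<in>?L. g j * (g (n - j) / g n) * (u (n - j) / g (n - j) - c))
          + (p * c * W n + p * S n - c)"
      by (simp only: distrib_left mult.assoc add.assoc add_diff_eq)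
    have "\<bar>\<Sum>j\<in>?L. g j * (g (n - j) / g n) * (u (n - j) / g (n - j) - c)\<bar>
        \<le> (\<Sum>j\<in>?L. g j * (g (n - j) / g n) * B)"
    proof (rule order_trans[OF sum_abs sum_mono])
      fix j assume j: "j \<in> ?L"
      show "\<bar>g j * (g (n - j) / g n) * (u (n - j) / g (n - j) - c)\<bar> \<le> g j * (g (n - j) / g n) * B"
      \<comment> \<open>At \<open>j = 0\<close> the ratio is the one at \<open>n\<close> itself,
        which \<open>B\<close> does not control; its weight is zero because
        \<open>g 0 = 0\<close>.\<close>
      proof (cases "j = 0")
        case False
        then have "\<bar>u (n - j) / g (n - j) - c\<bar> \<le> B"
          using j n by (intro B[rule_format]) auto
        moreover have w: "0 \<le> g j * (g (n - j) / g n)" using g(1) by simp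
        ultimately have "g j * (g (n - j) / g n) * \<bar>u (n - j) / g (n - j) - c\<bar>
            \<le> g j * (g (n - j) / g n) * B"
          by (rule mult_left_mono)
        then show ?thesis
          by (simp only: abs_mult [of "g j * (g (n - j) / g n)"] abs_of_nonneg [OF w])
      qed (simp add: g(3))
    qed
    also have "\<dots> = W n * B" by (simp add: W_def sum_distrib_right)
    finally have "p * \<bar>\<Sum>j\<in>?L. g j * (g (n - j) / g n) * (u (n - j) / g (n - j) - c)\<bar> \<le> p * (W n * B)"
      using p by (intro mult_left_mono) auto
    then show ?thesis
      unfolding eq \<delta>_def using p
      by (intro order_trans[OF abs_triangle_ineq] add_right_mono)
        (simp only: abs_mult abs_of_pos mult.assoc)
  qed
  have "(\<lambda>n. \<bar>u n / g n - c\<bar>) \<longlonglongrightarrow> 0"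
  proof (rule half_range_contraction_tendsto_0[OF _ q p(2) _ \<delta>])
    show "\<forall>\<^sub>F n in sequentially. \<forall>B. (\<forall>m<n. n \<le> 2 * m \<longrightarrow> \<bar>u m / g m - c\<bar> \<le> B) \<longrightarrow>
        \<bar>u n / g n - c\<bar> \<le> p * W n * B + \<delta> n"
      using eventually_ge_at_top[of "2 * N + 1"] by eventually_elim (intro allI impI, rule step)
  qed (use p W_nonneg in auto)
  then show ?thesis
    unfolding c_def by (rule LIM_zero_cancel[OF tendsto_rabs_zero_cancel])
qed

section \<open>Transfer to the return time law\<close>

theorem proposition3p2:
  fixes p C \<beta> :: real
    and f f_hole u_hole :: "nat \<Rightarrow> real"
    and \<nu> :: "'a measure" and \<tau> :: "'a \<Rightarrow> nat"
  assumes p: "0 < p" "p < 1"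
    and f_nonneg: "\<And>n. n \<ge> 1 \<Longrightarrow> 0 \<le> f n"
    and f_sum: "(f has_sum 1) {1..}"
    and f_gcd: "Gcd {n. n \<ge> 1 \<and> 0 < f n} = 1"
    and C: "0 < C" and \<beta>: "0 < \<beta>"
    and f_tail: "asymp_ratio_one (\<lambda>n. real n * f n) (\<lambda>n. C * (\<Sum>\<^sub>\<infinity>j\<in>{n<..}. f j))"
    and f_bigo: "f \<in> O[sequentially](\<lambda>n. real n powr (- (\<beta> + 1)))"
    and f_hole: "\<And>n. n \<ge> 1 \<Longrightarrow> f_hole n = p * f n"
    and u_hole_0: "u_hole 0 = 1"
    and u_hole_rec: "\<And>n. n \<ge> 1 \<Longrightarrow> u_hole n = (\<Sum>j=1..n. f_hole j * u_hole (n - j))"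
    and \<nu>: "prob_space \<nu>"
    and \<tau>: "\<tau> \<in> measurable \<nu> (count_space UNIV)"
    and \<tau>_law: "\<And>n. n \<ge> 1 \<Longrightarrow> measure \<nu> {x \<in> space \<nu>. \<tau> x = n} = f n"
  shows "asymp_ratio_one u_hole (\<lambda>n. f_hole n / (1 - p)\<^sup>2) \<and>
         asymp_ratio_one u_hole (\<lambda>n. p / (1 - p)\<^sup>2 * measure \<nu> {x \<in> space \<nu>. \<tau> x = n})"
proof -
  \<comment> \<open>The value \<open>f 0\<close> is unconstrained; setting it to 0 allows sums over
    all naturals and convolutions over \<open>j \<le> n\<close>.\<close>
  define g where "g = (\<lambda>n. if n = 0 then 0 else f n)"
  define T where "T = (\<lambda>n. \<Sum>\<^sub>\<infinity>j\<in>{n<..}. f j)"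
  have g_eq: "\<forall>\<^sub>F n in sequentially. g n = f n"
    using eventually_gt_at_top[of 0] by eventually_elim (simp add: g_def)
  have g: "0 \<le> g n" for n using f_nonneg[of n] by (simp add: g_def)
  have "(g has_sum 1) UNIV"
    using f_sum by (subst has_sum_cong_neutral[of "{1..}" _ f]) (auto simp: g_def)
  then have g_sums: "g sums 1" by (rule has_sum_imp_sums)
  have summable: "f summable_on {n<..}" for n
    by (rule summable_on_subset_banach[of f "{1..}"]) (use f_sum in \<open>auto simp: summable_on_def\<close>)
  have rec: "T n = g (Suc n) + T (Suc n)" for n
  proof -
    have "{n<..} = insert (Suc n) {Suc n<..}" by auto
    then show ?thesis using infsum_insert[OF summable, of "Suc n" "Suc n"] by (simp add: T_def g_def)
  qed
  have T_nonneg: "0 \<le> T n" for n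
    unfolding T_def using f_nonneg by (intro infsum_nonneg) auto
  have CT: "\<forall>\<^sub>F n in sequentially. C * T n \<noteq> 0" and equiv: "(\<lambda>n. real n * f n) \<sim>[sequentially] (\<lambda>n. C * T n)"
    using f_tail by (auto simp: asymp_ratio_one_def T_def)
  \<comment> \<open>Here the nonvanishing clause of \<open>asymp_ratio_one\<close> enters: it rules
    out finitely supported laws.\<close>
  have T_pos: "\<forall>\<^sub>F n in sequentially. 0 < T n"
    using CT
  proof eventually_elim
    case (elim n)
    then show ?case using T_nonneg[of n] by auto
  qed
  have "(\<lambda>n. C * (real n * f n / (C * T n))) \<longlonglongrightarrow> C * 1"
    using CT by (intro tendsto_intros asymp_equivD_strong[OF equiv]) (auto elim: eventually_mono)
  moreover have "\<forall>\<^sub>F n in sequentially. C * (real n * f n / (C * T n)) = real n * g n / T n"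
    using g_eq by eventually_elim (use C in simp)
  ultimately have "(\<lambda>n. real n * g n / T n) \<longlonglongrightarrow> C * 1"
    by (rule Lim_transform_eventually)
  then have lim: "(\<lambda>n. real n * g n / T n) \<longlonglongrightarrow> C" by simp
  have u_rec: "u_hole n = p * (\<Sum>j\<le>n. g j * u_hole (n - j))" if "n \<ge> 1" for n
  proof -
    have "(\<Sum>j\<le>n. g j * u_hole (n - j)) = (\<Sum>j=1..n. g j * u_hole (n - j))"
      by (rule sum.mono_neutral_right) (auto simp: g_def not_less_eq_eq)
    then show ?thesis
      using u_hole_rec[OF that] f_hole by (simp add: sum_distrib_left g_def mult.assoc)
  qed
  have "(\<lambda>n. u_hole n / g n) \<longlonglongrightarrow> p / (1 - p)\<^sup>2"
    by (rule defective_renewal_asymptotics[OF g g_sums _ p rec T_pos lim C u_hole_0 u_rec])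
      (simp add: g_def)
  then have main: "u_hole \<sim>[sequentially] (\<lambda>n. p / (1 - p)\<^sup>2 * g n)"
    using p by (intro asymp_equivI'_const) auto
  have "\<forall>\<^sub>F n in sequentially. 0 < g n"
    using tail_ratio_long_tailed(1)[OF rec T_pos lim C] .
  then have nonzero: "\<forall>\<^sub>F n in sequentially. p / (1 - p)\<^sup>2 * g n \<noteq> 0"
    by eventually_elim (use p in auto)
  \<comment> \<open>Both comparison sequences of the claim agree with
    \<open>p / (1 - p)\<^sup>2 * g n\<close> for \<open>n \<ge> 1\<close>, so one argument serves
    both.\<close>
  have conclusion: "asymp_ratio_one u_hole b" if "\<And>n. n \<ge> 1 \<Longrightarrow> b n = p / (1 - p)\<^sup>2 * g n" for b
  proof -
    have b: "\<forall>\<^sub>F n in sequentially. p / (1 - p)\<^sup>2 * g n = b n"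
      using eventually_ge_at_top[of 1] by eventually_elim (simp add: that)
    from nonzero b have "\<forall>\<^sub>F n in sequentially. b n \<noteq> 0"
      by eventually_elim metis
    with asymp_equiv_transfer[OF main _ b] show ?thesis
      by (simp add: asymp_ratio_one_def)
  qed
  show ?thesis
    by (intro conjI conclusion) (auto simp: f_hole \<tau>_law g_def)
qed

end
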